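(* Let $\lambda>0$ and let $H:T^*\mathbb{T}^n\to\mathbb{R}$ be a $C^r$ ($r\geq 2$) Tonelli Hamiltonian. For each KAM torus $\mathcal{T}_\omega$ of the conformally symplectic system generated by $H$ and $\lambda$, the stationary discounted Hamilton-Jacobi equation $$H(x,\partial_xu(x))+\lambda u(x)=0,\qquad x\in\mathbb{T}^n,$$ has a unique classical solution $u_\omega^-$, and it satisfies $\mathcal{T}_\omega=\mathrm{Graph}(d_xu_\omega^-)=\{(x,d_xu_\omega^-(x)):x\in\mathbb{T}^n\}$. Consequently, the KAM torus is unique, i.e. the system has at most one KAM torus.
   Context: $\mathbb{T}^n=\mathbb{R}^n/\mathbb{Z}^n$ and $T^*\mathbb{T}^n=\mathbb{T}^n\times\mathbb{R}^n$ with coordinates $(x,p)$. A Hamiltonian $H$ is Tonelli if $H_{pp}(x,p)$ is positive definite for every $(x,p)$ and $\lim_{|p|\to+\infty}H(x,p)/|p|=+\infty$ for every $x$. The conformally symplectic system generated by $H$ and $\lambda$ is $$\dot x=H_p(x,p),\qquad \dot p=-H_x(x,p)-\lambda p ,$$ with (local) flow $\Phi^t_{H,\lambda}$. KAM torus: a homologically nontrivial, $C^1$-graphic (i.e. the graph of a $C^1$ map $\mathbb{T}^n\to\mathbb{R}^n$), $\Phi^t_{H,\lambda}$-invariant set $\mathcal{T}_\omega$ on which the dynamics is conjugate to the rotation of frequency $\omega\in\mathbb{R}^n$. That is, there is a $C^1$ embedding $K:\mathbb{T}^n\to T^*\mathbb{T}^n$, $K(x)=(\zeta(x),\eta(x))$,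 with (for lifts to $\mathbb{R}^n$) $\zeta(x+m)=\zeta(x)+m$, $\eta(x+m)=\eta(x)$ for all $m\in\mathbb{Z}^n$, such that $\Phi^t_{H,\lambda}(K(x))=K(x+\omega t)$ for all $x\in\mathbb{T}^n$, $t\in\mathbb{R}$, and $\mathcal{T}_\omega=K(\mathbb{T}^n)=\{(x,\eta(\zeta^{-1}(x))) : x\in\mathbb{T}^n\}$. A classical solution is a $C^1$ function satisfying the equation at every point. *)

theory Defs
  imports "HOL-Analysis.Analysis"
begin

text \<open>
  Objects on the torus \<open>\<real>\<^sup>n/\<int>\<^sup>n\<close> and on its cotangent bundle are represented by their lifts to
  \<open>\<real>\<^sup>n\<close> and \<open>\<real>\<^sup>n \<times> \<real>\<^sup>n\<close>: functions are \<open>\<int>\<^sup>n\<close>-periodic in \<open>x\<close>, and a subset of the cotangent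
  bundle is represented by its full preimage, so that equality of subsets is equality of
  preimages.  Covectors are identified with vectors by the Euclidean inner product.
\<close>

definition int_lattice :: "(real^'n) set" where
  "int_lattice = {m. \<forall>i. m $ i \<in> \<int>}"

definition torus_periodic :: "(real^'n \<Rightarrow> 'b) \<Rightarrow> bool" where
  "torus_periodic f \<longleftrightarrow> (\<forall>x. \<forall>m\<in>int_lattice. f (x + m) = f x)"

text \<open>Class \<open>C\<^sup>k\<close> on the whole space; in finite dimension it suffices to ask that all
  directional derivatives of \<open>f\<close> be of class \<open>C\<^sup>k\<^sup>-\<^sup>1\<close>.\<close>

fun C_class :: "nat \<Rightarrow> ('a::euclidean_space \<Rightarrow> 'b::real_normed_vector) \<Rightarrow> bool" where
  "C_class 0 f \<longleftrightarrow> continuous_on UNIV f"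
| "C_class (Suc k) f \<longleftrightarrow>
     (\<forall>x. f differentiable (at x)) \<and> (\<forall>v. C_class k (\<lambda>x. frechet_derivative f (at x) v))"

definition grad :: "('a::real_inner \<Rightarrow> real) \<Rightarrow> 'a \<Rightarrow> 'a" where
  "grad f x = (THE D. GDERIV f x :> D)"

definition H_x :: "((real^'n) \<times> (real^'n) \<Rightarrow> real) \<Rightarrow> real^'n \<Rightarrow> real^'n \<Rightarrow> real^'n" where
  "H_x H x p = grad (\<lambda>y. H (y, p)) x"

definition H_p :: "((real^'n) \<times> (real^'n) \<Rightarrow> real) \<Rightarrow> real^'n \<Rightarrow> real^'n \<Rightarrow> real^'n" where
  "H_p H x p = grad (\<lambda>q. H (x, q)) p"

definition H_pp :: "((real^'n) \<times> (real^'n) \<Rightarrow> real) \<Rightarrow> real^'n \<Rightarrow> real^'n \<Rightarrow> real^'n \<Rightarrow> real^'n" where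
  "H_pp H x p = frechet_derivative (\<lambda>q. H_p H x q) (at p)"

definition tonelli :: "((real^'n) \<times> (real^'n) \<Rightarrow> real) \<Rightarrow> bool" where
  "tonelli H \<longleftrightarrow>
     (\<forall>x p v. v \<noteq> 0 \<longrightarrow> H_pp H x p v \<bullet> v > 0) \<and>
     (\<forall>x. filterlim (\<lambda>p. H (x, p) / norm p) at_top at_infinity)"

definition conf_field ::
  "((real^'n) \<times> (real^'n) \<Rightarrow> real) \<Rightarrow> real \<Rightarrow> (real^'n) \<times> (real^'n) \<Rightarrow> (real^'n) \<times> (real^'n)" where
  "conf_field H lam = (\<lambda>(x, p). (H_p H x p, - H_x H x p - lam *\<^sub>R p))"

text \<open>The local flow is a partial function, given by its graph: \<open>conf_flow H lam t z w\<close> says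
  that the solution starting at \<open>z\<close> exists up to time \<open>t\<close> and is at \<open>w\<close> at that time.\<close>

definition conf_flow ::
  "((real^'n) \<times> (real^'n) \<Rightarrow> real) \<Rightarrow> real \<Rightarrow> real \<Rightarrow>
     (real^'n) \<times> (real^'n) \<Rightarrow> (real^'n) \<times> (real^'n) \<Rightarrow> bool" where
  "conf_flow H lam t z w \<longleftrightarrow>
     (\<exists>J \<gamma>. open J \<and> is_interval J \<and> 0 \<in> J \<and> t \<in> J \<and> \<gamma> 0 = z \<and> \<gamma> t = w \<and>
        (\<forall>s\<in>J. (\<gamma> has_vector_derivative conf_field H lam (\<gamma> s)) (at s)))"

text \<open>Lift of a \<open>C\<^sup>1\<close> embedding of the torus into its cotangent bundle whose base component is
  homotopic to the identity: an immersion that is injective modulo \<open>\<int>\<^sup>n\<close>.  It is a homeomorphism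
  onto its image by compactness of the torus.\<close>

definition torus_embedding :: "(real^'n \<Rightarrow> real^'n) \<Rightarrow> (real^'n \<Rightarrow> real^'n) \<Rightarrow> bool" where
  "torus_embedding \<zeta> \<eta> \<longleftrightarrow>
     (\<forall>x. \<forall>m\<in>int_lattice. \<zeta> (x + m) = \<zeta> x + m) \<and> torus_periodic \<eta> \<and>
     C_class 1 (\<lambda>x. (\<zeta> x, \<eta> x)) \<and>
     (\<forall>x. inj (frechet_derivative (\<lambda>y. (\<zeta> y, \<eta> y)) (at x))) \<and>
     (\<forall>x y. \<zeta> y - \<zeta> x \<in> int_lattice \<and> \<eta> y = \<eta> x \<longrightarrow> y - x \<in> int_lattice)"

text \<open>\<open>T\<close> is the preimage in \<open>\<real>\<^sup>n \<times> \<real>\<^sup>n\<close> of the torus; since \<open>\<zeta>\<close> commutes with the translations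
  by \<open>\<int>\<^sup>n\<close>, this is the range of the lifted embedding.\<close>

definition KAM_torus ::
  "((real^'n) \<times> (real^'n) \<Rightarrow> real) \<Rightarrow> real \<Rightarrow> real^'n \<Rightarrow> ((real^'n) \<times> (real^'n)) set \<Rightarrow> bool" where
  "KAM_torus H lam \<omega> T \<longleftrightarrow>
     (\<exists>\<zeta> \<eta>. torus_embedding \<zeta> \<eta> \<and>
        (\<forall>x t. conf_flow H lam t (\<zeta> x, \<eta> x) (\<zeta> (x + t *\<^sub>R \<omega>), \<eta> (x + t *\<^sub>R \<omega>))) \<and>
        T = range (\<lambda>x. (\<zeta> x, \<eta> x)) \<and>
        bij \<zeta> \<and> C_class 1 (\<lambda>x. \<eta> (inv \<zeta> x)) \<and>
        T = range (\<lambda>x. (x, \<eta> (inv \<zeta> x))))"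

definition classical_solution ::
  "((real^'n) \<times> (real^'n) \<Rightarrow> real) \<Rightarrow> real \<Rightarrow> (real^'n \<Rightarrow> real) \<Rightarrow> bool" where
  "classical_solution H lam u \<longleftrightarrow>
     torus_periodic u \<and> C_class 1 u \<and> (\<forall>x. H (x, grad u x) + lam * u x = 0)"

definition graph_d :: "(real^'n \<Rightarrow> real) \<Rightarrow> ((real^'n) \<times> (real^'n)) set" where
  "graph_d u = range (\<lambda>x. (x, grad u x))"

end

theory Submission
  imports Defs
begin

text \<open>
  Let \<open>P = \<eta> \<circ> \<zeta>\<^sup>-\<^sup>1\<close>.  If the torus is the graph of \<open>du\<close> for a solution \<open>u\<close>, the equation forces
  \<open>u = - H(x, P(x)) / \<lambda>\<close>, so it suffices to show that this \<open>u\<close> satisfies \<open>du = P\<close>.  Along an orbit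
  on the torus \<open>u\<close> has derivative \<open>p \<bullet> H\<^sub>p\<close>, and interchanging the derivatives along the rotation
  and in a direction \<open>v\<close> shows that the pull-back of \<open>du - P\<close> to the torus decays like
  \<open>e\<^sup>-\<^sup>\<lambda>\<^sup>t\<close>; being bounded for all negative times, it is zero.  Solutions are unique because at a maximum of
  \<open>u - v\<close> the gradients agree, so that the equation gives \<open>u = v\<close> there.
\<close>

section \<open>Functions of class $C^1$\<close>

lemma C_class_1_iff:
  "C_class 1 f \<longleftrightarrow> (\<forall>x. f differentiable (at x)) \<and>
     (\<forall>v. continuous_on UNIV (\<lambda>x. frechet_derivative f (at x) v))"
  by simp

lemma C_class_1_has_derivative:
  assumes "C_class 1 f"
  shows "(f has_derivative frechet_derivative f (at x)) (at x)"
  using assms unfolding C_class_1_iff frechet_derivative_works by blast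

lemma C_class_1I:
  fixes f :: "'a::euclidean_space \<Rightarrow> 'b::real_normed_vector"
  assumes "\<And>x. (f has_derivative f' x) (at x)"
    and "\<And>v. continuous_on UNIV (\<lambda>x. f' x v)"
  shows "C_class 1 f"
proof -
  have "frechet_derivative f (at x) = f' x" for x
    using frechet_derivative_at[OF assms(1)] by simp
  then show ?thesis
    unfolding C_class_1_iff using assms by (auto simp: differentiable_def)
qed

lemma C_class_1_continuous_on:
  assumes "C_class 1 f"
  shows "continuous_on S f"
  using C_class_1_has_derivative[OF assms] has_derivative_continuous
  by (metis continuous_at_imp_continuous_on)

lemma C_class_Suc_imp:
  assumes "C_class (Suc k) f"
  shows "C_class k f"
  using assms
proof (induction k arbitrary: f)
  case 0
  then show ?case
    using C_class_1_continuous_on[of f UNIV] by simp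
next
  case (Suc k)
  then show ?case
    by (metis C_class.simps(2))
qed

lemma C_class_mono:
  assumes "C_class k f" "j \<le> k"
  shows "C_class j f"
  using assms(2,1) by (induction rule: inc_induct) (auto intro: C_class_Suc_imp)

section \<open>Joint continuity of the derivative in the base point and the direction\<close>

lemma linear_expand_Basis:
  fixes L :: "'a::euclidean_space \<Rightarrow> 'b::real_vector"
  assumes "linear L"
  shows "L w = (\<Sum>b\<in>Basis. (w \<bullet> b) *\<^sub>R L b)"
proof -
  have "L w = L (\<Sum>b\<in>Basis. (w \<bullet> b) *\<^sub>R b)"
    by (simp add: euclidean_representation)
  also have "\<dots> = (\<Sum>b\<in>Basis. (w \<bullet> b) *\<^sub>R L b)"
    by (simp only: linear_sum[OF assms] linear_cmul[OF assms] o_def)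
  finally show ?thesis .
qed

lemma linear_frechet_derivative_C_class_1:
  assumes "C_class 1 f"
  shows "linear (frechet_derivative f (at x))"
  using C_class_1_has_derivative[OF assms] has_derivative_linear by blast

text \<open>\<open>C_class\<close> only speaks of one fixed direction at a time. Expanding the
  direction in the basis, with continuous coefficients, leaves finitely many such
  statements.\<close>

lemma continuous_on_frechet_derivative:
  fixes f :: "'a::euclidean_space \<Rightarrow> 'b::real_normed_vector"
  assumes f: "C_class 1 f" and g: "continuous_on S g" and h: "continuous_on S h"
  shows "continuous_on S (\<lambda>x. frechet_derivative f (at (g x)) (h x))"
proof -
  have "continuous_on S (\<lambda>x. frechet_derivative f (at (g x)) b)" for b
  proof -
    have "continuous_on UNIV (\<lambda>x. frechet_derivative f (at x) b)"
      using f C_class_1_iff by blast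
    from continuous_on_compose2[OF this g] show ?thesis by simp
  qed
  then have "continuous_on S (\<lambda>x. \<Sum>b\<in>Basis. (h x \<bullet> b) *\<^sub>R frechet_derivative f (at (g x)) b)"
    by (intro continuous_intros h)
  then show ?thesis
    by (subst linear_expand_Basis[OF linear_frechet_derivative_C_class_1[OF f]])
qed

section \<open>Closure of the class C^1 under composition and algebraic operations\<close>

lemma C_class_1_compose:
  fixes g :: "'a::euclidean_space \<Rightarrow> 'b::euclidean_space"
    and f :: "'b \<Rightarrow> 'c::real_normed_vector"
  assumes f: "C_class 1 f" and g: "C_class 1 g"
  shows "C_class 1 (\<lambda>x. f (g x))"
proof (rule C_class_1I)
  show "((\<lambda>x. f (g x)) has_derivative
      (\<lambda>v. frechet_derivative f (at (g x)) (frechet_derivative g (at x) v))) (at x)" for x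
    by (rule has_derivative_compose[OF C_class_1_has_derivative[OF g] C_class_1_has_derivative[OF f]])
  show "continuous_on UNIV
      (\<lambda>x. frechet_derivative f (at (g x)) (frechet_derivative g (at x) v))" for v
    by (intro continuous_on_frechet_derivative f g C_class_1_continuous_on continuous_intros)
qed

lemma C_class_1_bounded_linear:
  fixes L :: "'a::euclidean_space \<Rightarrow> 'b::real_normed_vector"
  assumes "bounded_linear L"
  shows "C_class 1 L"
  by (rule C_class_1I[of _ "\<lambda>_. L"])
    (auto intro: bounded_linear_imp_has_derivative[OF assms])

lemma C_class_1_add:
  fixes f g :: "'a::euclidean_space \<Rightarrow> 'b::real_normed_vector"
  assumes f: "C_class 1 f" and g: "C_class 1 g"
  shows "C_class 1 (\<lambda>x. f x + g x)"
  by (rule C_class_1I)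
    (rule has_derivative_add[OF C_class_1_has_derivative[OF f] C_class_1_has_derivative[OF g]],
     intro continuous_intros continuous_on_frechet_derivative f g)

lemma C_class_1_sum:
  fixes f :: "'i \<Rightarrow> 'a::euclidean_space \<Rightarrow> 'b::real_normed_vector"
  assumes f: "\<And>i. i \<in> I \<Longrightarrow> C_class 1 (f i)"
  shows "C_class 1 (\<lambda>x. \<Sum>i\<in>I. f i x)"
  by (rule C_class_1I)
    (rule has_derivative_sum, erule C_class_1_has_derivative[OF f],
     intro continuous_intros continuous_on_frechet_derivative f)

lemma C_class_1_inner:
  fixes f g :: "'a::euclidean_space \<Rightarrow> 'b::euclidean_space"
  assumes f: "C_class 1 f" and g: "C_class 1 g"
  shows "C_class 1 (\<lambda>x. f x \<bullet> g x)"
  by (rule C_class_1I)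
    (rule has_derivative_inner[OF C_class_1_has_derivative[OF f] C_class_1_has_derivative[OF g]],
     intro continuous_intros continuous_on_frechet_derivative f g C_class_1_continuous_on)

lemma C_class_1_Pair:
  fixes f :: "'a::euclidean_space \<Rightarrow> 'b::real_normed_vector"
    and g :: "'a \<Rightarrow> 'c::real_normed_vector"
  assumes f: "C_class 1 f" and g: "C_class 1 g"
  shows "C_class 1 (\<lambda>x. (f x, g x))"
  by (rule C_class_1I)
    (rule has_derivative_Pair[OF C_class_1_has_derivative[OF f] C_class_1_has_derivative[OF g]],
     intro continuous_intros continuous_on_frechet_derivative f g)

text \<open>Mean value inequality on a convex set. The sum of the norms of the basis derivatives
  bounds the operator norm and is visibly continuous, hence bounded on \<open>S\<close>.\<close>

lemma C_class_1_lipschitz_on_compact: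
  fixes f :: "'a::euclidean_space \<Rightarrow> 'b::real_normed_vector"
  assumes f: "C_class 1 f" and S: "compact S" "convex S"
  obtains L where "\<And>x y. x \<in> S \<Longrightarrow> y \<in> S \<Longrightarrow> norm (f x - f y) \<le> L * norm (x - y)"
proof -
  let ?D = "\<lambda>x. frechet_derivative f (at x)"
  have "compact ((\<lambda>x. \<Sum>b\<in>Basis. norm (?D x b)) ` S)"
    by (intro compact_continuous_image S continuous_intros continuous_on_frechet_derivative f)
  from compact_imp_bounded[OF this] obtain L where
    "\<forall>z\<in>(\<lambda>x. \<Sum>b\<in>Basis. norm (?D x b)) ` S. norm z \<le> L"
    unfolding bounded_iff by blast
  then have L: "\<bar>\<Sum>b\<in>Basis. norm (?D x b)\<bar> \<le> L" if "x \<in> S" for x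
    using that by simp
  have "onorm (?D x) \<le> L" if "x \<in> S" for x
  proof (rule onorm_le)
    fix v
    have "norm (?D x v) \<le> (\<Sum>b\<in>Basis. norm ((v \<bullet> b) *\<^sub>R ?D x b))"
      by (subst linear_expand_Basis[OF linear_frechet_derivative_C_class_1[OF f]]) (rule norm_sum)
    also have "\<dots> \<le> (\<Sum>b\<in>Basis. norm v * norm (?D x b))"
      by (intro sum_mono) (auto intro: mult_right_mono Basis_le_norm)
    also have "\<dots> \<le> L * norm v"
      using mult_right_mono[OF abs_le_D1[OF L[OF that]] norm_ge_zero[of v]]
      by (simp add: sum_distrib_left mult.commute)
    finally show "norm (?D x v) \<le> L * norm v" .
  qed
  then have "norm (f x - f y) \<le> L * norm (x - y)" if "x \<in> S" "y \<in> S" for x y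
    using that S(2) has_derivative_at_withinI[OF C_class_1_has_derivative[OF f]]
    by (intro differentiable_bound[of S f ?D]) auto
  then show thesis using that by blast
qed

section \<open>Derivatives along lines and the interchange of directional derivatives\<close>

lemma has_vector_derivative_along_line:
  assumes "(f has_derivative D) (at (x + t *\<^sub>R w))"
  shows "((\<lambda>t. f (x + t *\<^sub>R w)) has_vector_derivative D w) (at t within S)"
proof -
  have "((\<lambda>t. x + t *\<^sub>R w) has_vector_derivative w) (at t within S)"
    by (auto intro!: derivative_eq_intros)
  from vector_derivative_diff_chain_within[OF this, of f D] assms
  show ?thesis by (simp add: o_def has_derivative_at_withinI)
qed

text \<open>A version of Schwarz's theorem: differentiate
  \<open>f (x + t w) - f (x - w) = \<integral> g (x + \<tau> w) d\<tau>\<close> under the integral sign.\<close>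

lemma frechet_derivative_along_line:
  fixes f g :: "'a::euclidean_space \<Rightarrow> 'b::euclidean_space"
  assumes f: "C_class 1 f" and g: "C_class 1 g"
    and fg: "\<And>x. frechet_derivative f (at x) w = g x"
  shows "((\<lambda>t. frechet_derivative f (at (x + t *\<^sub>R w)) v) has_vector_derivative
            frechet_derivative g (at (x + t *\<^sub>R w)) v) (at t)"
proof -
  \<comment> \<open>Time 0 at an arbitrary base point is enough: the line through \<open>x\<close>
    can be restarted from any of its points.\<close>
  have zero: "((\<lambda>t. frechet_derivative f (at (x + t *\<^sub>R w)) v) has_vector_derivative
            frechet_derivative g (at x) v) (at 0)" for x
  proof -
    let ?F = "\<lambda>x. frechet_derivative f (at x)" and ?G = "\<lambda>x. frechet_derivative g (at x)"
    have line: "((\<lambda>t. f (y + t *\<^sub>R w)) has_vector_derivative g (y + t *\<^sub>R w)) (at t within S)" for y t S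
      using has_vector_derivative_along_line[OF C_class_1_has_derivative[OF f], of y w t S]
      by (simp add: fg)
    \<comment> \<open>The lower limit \<open>-1\<close> puts time 0 in the interior of the range of
      integration, so that a two-sided derivative is obtained there.\<close>
    have int: "((\<lambda>\<tau>. g (x + s *\<^sub>R v + \<tau> *\<^sub>R w)) has_integral
        f (x + s *\<^sub>R v + t *\<^sub>R w) - f (x + s *\<^sub>R v + (-1) *\<^sub>R w)) {-1..t}" if "-1 \<le> t" for s t
      by (rule fundamental_theorem_of_calculus[OF that]) (rule line)
    \<comment> \<open>Both sides are derivatives at \<open>s = 0\<close> of the two sides of
      \<open>int\<close>. The derivative passes under the integral because the derivative of
      \<open>g\<close> in direction \<open>v\<close> is continuous.\<close>
    have eq: "?F (x + t *\<^sub>R w) v - ?F (x + (-1) *\<^sub>R w) v = integral {-1..t} (\<lambda>\<tau>. ?G (x + \<tau> *\<^sub>R w) v)"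
      if t: "-1 \<le> t" for t
    proof -
      have "((\<lambda>s. integral (cbox (-1) t) (\<lambda>\<tau>. g (x + s *\<^sub>R v + \<tau> *\<^sub>R w))) has_vector_derivative
          integral (cbox (-1) t) (\<lambda>\<tau>. ?G (x + 0 *\<^sub>R v + \<tau> *\<^sub>R w) v)) (at 0 within UNIV)"
      proof (rule leibniz_rule_vector_derivative)
        show "((\<lambda>s. g (x + s *\<^sub>R v + \<tau> *\<^sub>R w)) has_vector_derivative
            ?G (x + s *\<^sub>R v + \<tau> *\<^sub>R w) v) (at s within UNIV)" for s \<tau>
          using has_vector_derivative_along_line[OF C_class_1_has_derivative[OF g],
              of "x + \<tau> *\<^sub>R w" v s UNIV] by (simp add: add_ac)
        show "(\<lambda>\<tau>. g (x + s *\<^sub>R v + \<tau> *\<^sub>R w)) integrable_on cbox (-1) t" for s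
          using int[OF t] by (auto simp: integrable_on_def)
        show "continuous_on (UNIV \<times> cbox (-1) t) (\<lambda>(s, \<tau>). ?G (x + s *\<^sub>R v + \<tau> *\<^sub>R w) v)"
          unfolding case_prod_beta
          by (intro continuous_on_frechet_derivative g continuous_intros)
      qed auto
      moreover have "(\<lambda>s. integral (cbox (-1) t) (\<lambda>\<tau>. g (x + s *\<^sub>R v + \<tau> *\<^sub>R w))) =
          (\<lambda>s. f ((x + t *\<^sub>R w) + s *\<^sub>R v) - f ((x + (-1) *\<^sub>R w) + s *\<^sub>R v))"
      proof
        fix s
        have "x + t *\<^sub>R w + s *\<^sub>R v = x + s *\<^sub>R v + t *\<^sub>R w"
          "x + (-1) *\<^sub>R w + s *\<^sub>R v = x + s *\<^sub>R v + (-1) *\<^sub>R w"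
          by (simp_all add: algebra_simps)
        then show "integral (cbox (-1) t) (\<lambda>\<tau>. g (x + s *\<^sub>R v + \<tau> *\<^sub>R w)) =
            f ((x + t *\<^sub>R w) + s *\<^sub>R v) - f ((x + (-1) *\<^sub>R w) + s *\<^sub>R v)"
          using integral_unique[OF int[OF t, of s]] by (simp only: box_real)
      qed
      moreover have "((\<lambda>s. f ((x + t *\<^sub>R w) + s *\<^sub>R v) - f ((x + (-1) *\<^sub>R w) + s *\<^sub>R v))
          has_vector_derivative ?F (x + t *\<^sub>R w + 0 *\<^sub>R v) v - ?F (x + (-1) *\<^sub>R w + 0 *\<^sub>R v) v) (at 0)"
        by (intro has_vector_derivative_diff has_vector_derivative_along_line C_class_1_has_derivative f)
      ultimately show ?thesis
        using vector_derivative_unique_at by fastforce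
    qed
    have "continuous_on {-1..1} (\<lambda>\<tau>. ?G (x + \<tau> *\<^sub>R w) v)"
      by (intro continuous_on_frechet_derivative g continuous_intros)
    from integral_has_vector_derivative[OF this, of 0]
    have "((\<lambda>t. integral {-1..t} (\<lambda>\<tau>. ?G (x + \<tau> *\<^sub>R w) v)) has_vector_derivative ?G x v) (at 0 within {-1<..<1})"
      by (auto intro: has_vector_derivative_within_subset)
    then have "((\<lambda>t. integral {-1..t} (\<lambda>\<tau>. ?G (x + \<tau> *\<^sub>R w) v) + ?F (x + (-1) *\<^sub>R w) v)
        has_vector_derivative ?G x v) (at 0 within {-1<..<1})"
      by (auto intro!: derivative_eq_intros)
    then have "((\<lambda>t. ?F (x + t *\<^sub>R w) v) has_vector_derivative ?G x v) (at 0 within {-1<..<1})"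
      by (rule has_vector_derivative_transform[rotated 2]) (auto simp flip: eq)
    then show ?thesis
      by (subst (asm) at_within_open) auto
  qed
  \<comment> \<open>Shifting time carries \<open>zero\<close> at the base point reached at time
    \<open>t\<close> over to the derivative at \<open>t\<close>.\<close>
  have "((\<lambda>t. t - t0) has_vector_derivative 1) (at t0)" for t0 :: real
    by (auto intro!: derivative_eq_intros simp flip: has_real_derivative_iff_has_vector_derivative)
  from vector_diff_chain_at[OF this[of t], where g = "\<lambda>s. frechet_derivative f (at (x + t *\<^sub>R w + s *\<^sub>R w)) v"]
  show ?thesis using zero[of "x + t *\<^sub>R w"] by (simp add: o_def algebra_simps)
qed

section \<open>Gradients\<close>

text \<open>A vector is determined by its inner products, so the definite description behind
  \<open>grad\<close> has at most one candidate.\<close>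

lemma gderiv_eq_grad:
  assumes "GDERIV f x :> D"
  shows "grad f x = D"
proof -
  have "E = D" if "GDERIV f x :> E" for E
  proof -
    have "(\<lambda>h. h \<bullet> E) = (\<lambda>h. h \<bullet> D)"
      using that assms has_derivative_unique unfolding gderiv_def by blast
    then show ?thesis by (metis inner_commute vector_eq_ldot)
  qed
  then show ?thesis
    unfolding grad_def using assms by blast
qed

text \<open>Riesz representation in coordinates. The formula shows that equal derivatives give equal
  gradients and that \<open>grad f\<close> inherits the regularity of the directional
  derivatives.\<close>

lemma grad_eq_sum:
  fixes f :: "'a::euclidean_space \<Rightarrow> real"
  assumes "(f has_derivative f') (at x)"
  shows "grad f x = (\<Sum>b\<in>Basis. f' b *\<^sub>R b)"
proof (rule gderiv_eq_grad)
  have "f' h = h \<bullet> (\<Sum>b\<in>Basis. f' b *\<^sub>R b)" for h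
    using linear_expand_Basis[OF has_derivative_linear[OF assms], of h]
    by (simp add: inner_sum_right mult.commute)
  then show "GDERIV f x :> (\<Sum>b\<in>Basis. f' b *\<^sub>R b)"
    unfolding gderiv_def by (intro has_derivative_eq_rhs[OF assms] ext)
qed

lemma inner_grad:
  fixes f :: "'a::euclidean_space \<Rightarrow> real"
  assumes "(f has_derivative f') (at x)"
  shows "f' h = grad f x \<bullet> h"
  using linear_expand_Basis[OF has_derivative_linear[OF assms], of h]
  by (simp add: grad_eq_sum[OF assms] inner_sum_left inner_commute[of h] mult.commute)

lemma C_class_1_grad:
  fixes f :: "'a::euclidean_space \<Rightarrow> real"
  assumes "C_class 2 f"
  shows "C_class 1 (grad f)"
proof -
  have f1: "C_class 1 f"
    using C_class_mono[OF assms, of 1] by simp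
  have fv: "C_class 1 (\<lambda>x. frechet_derivative f (at x) v)" for v
    using assms by (simp add: numeral_2_eq_2)
  have "grad f = (\<lambda>x. \<Sum>b\<in>Basis. frechet_derivative f (at x) b *\<^sub>R b)"
    using grad_eq_sum[OF C_class_1_has_derivative[OF f1]] by blast
  moreover have "C_class 1 (\<lambda>x. \<Sum>b\<in>Basis. frechet_derivative f (at x) b *\<^sub>R b)"
    by (intro C_class_1_sum C_class_1_compose[OF C_class_1_bounded_linear fv]
        bounded_linear_scaleR_left)
  ultimately show ?thesis by simp
qed

text \<open>Restricting the full derivative to vertical and horizontal directions yields the partial
  gradients, so the vector field can be handled through \<open>grad H\<close> alone.\<close>

lemma H_p_H_x_eq_grad:
  assumes "H differentiable (at (x, p))"
  shows "H_p H x p = snd (grad H (x, p))" "H_x H x p = fst (grad H (x, p))"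
proof -
  obtain D where D: "(H has_derivative D) (at (x, p))"
    using assms differentiable_def by blast
  have "((\<lambda>q. H (x, q)) has_derivative (\<lambda>h. D (0, h))) (at p)"
    by (rule has_derivative_compose[of "\<lambda>q. (x, q)", OF _ D]) (auto intro!: derivative_eq_intros)
  moreover have "D (0, h) = h \<bullet> snd (grad H (x, p))" for h
    by (simp add: inner_grad[OF D] inner_prod_def inner_commute)
  ultimately show "H_p H x p = snd (grad H (x, p))"
    unfolding H_p_def by (intro gderiv_eq_grad) (simp add: gderiv_def)
  have "((\<lambda>y. H (y, p)) has_derivative (\<lambda>h. D (h, 0))) (at x)"
    by (rule has_derivative_compose[of "\<lambda>y. (y, p)", OF _ D]) (auto intro!: derivative_eq_intros)
  moreover have "D (h, 0) = h \<bullet> fst (grad H (x, p))" for h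
    by (simp add: inner_grad[OF D] inner_prod_def inner_commute)
  ultimately show "H_x H x p = fst (grad H (x, p))"
    unfolding H_x_def by (intro gderiv_eq_grad) (simp add: gderiv_def)
qed

section \<open>Periodic functions\<close>

text \<open>Fractional parts move any point into the unit cube. Compactness of the cube then
  replaces compactness of the torus.\<close>

lemma torus_periodic_representative:
  fixes f :: "real^'n \<Rightarrow> 'b"
  assumes "torus_periodic f"
  obtains y where "y \<in> cbox 0 1" "f x = f y"
proof
  let ?y = "(\<chi> i. frac (x $ i)) :: real^'n" and ?m = "(\<chi> i. of_int \<lfloor>x $ i\<rfloor>) :: real^'n"
  show "?y \<in> cbox 0 1"
    by (auto simp: mem_box_cart less_imp_le[OF frac_lt_1])
  have "x = ?y + ?m" "?m \<in> int_lattice"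
    by (auto simp: vec_eq_iff frac_def int_lattice_def)
  then show "f x = f ?y"
    using assms unfolding torus_periodic_def by metis
qed

lemma torus_periodic_bounded:
  fixes f :: "real^'n \<Rightarrow> real"
  assumes "torus_periodic f" "continuous_on UNIV f"
  obtains B where "\<And>x. \<bar>f x\<bar> \<le> B"
proof -
  have "compact (f ` cbox 0 1)"
    by (intro compact_continuous_image continuous_on_subset[OF assms(2)]) auto
  from compact_imp_bounded[OF this] obtain B where "\<forall>z\<in>f ` cbox 0 1. norm z \<le> B"
    unfolding bounded_iff by blast
  then have B: "\<bar>f y\<bar> \<le> B" if "y \<in> cbox 0 1" for y
    using that by simp
  have "\<bar>f x\<bar> \<le> B" for x
    using torus_periodic_representative[OF assms(1), of x] B by metis
  then show thesis using that by blast
qed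

lemma torus_periodic_attains_sup:
  fixes f :: "real^'n \<Rightarrow> real"
  assumes "torus_periodic f" "continuous_on UNIV f"
  obtains y where "\<And>x. f x \<le> f y"
proof -
  have "(0::real^'n) \<in> cbox 0 1"
    by (simp add: mem_box_cart)
  then obtain y where y: "\<And>x. x \<in> cbox 0 1 \<Longrightarrow> f x \<le> f y"
    using continuous_attains_sup[of "cbox 0 (1::real^'n)" f] continuous_on_subset[OF assms(2)]
    by (metis compact_cbox empty_iff subset_UNIV)
  have "f x \<le> f y" for x
    using torus_periodic_representative[OF assms(1), of x] y by metis
  then show thesis using that by blast
qed

text \<open>The constant \<open>c\<close> covers both periodic functions, with \<open>c = 0\<close>,
  and lifts of maps homotopic to the identity, with \<open>c = m\<close>.\<close>

lemma frechet_derivative_translate: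
  assumes "\<And>x. f differentiable (at x)" "\<And>x. f (x + m) = f x + c"
  shows "frechet_derivative f (at (x + m)) = frechet_derivative f (at x)"
proof -
  have "((\<lambda>y. f (y + m)) has_derivative (\<lambda>h. frechet_derivative f (at (x + m)) h)) (at x)"
    by (rule has_derivative_compose[of "\<lambda>y. y + m"])
      (use assms(1) in \<open>auto intro!: derivative_eq_intros simp flip: frechet_derivative_works\<close>)
  then have "((\<lambda>y. f (y + m) - c) has_derivative (\<lambda>h. frechet_derivative f (at (x + m)) h - 0)) (at x)"
    by (intro has_derivative_diff has_derivative_const)
  then show ?thesis
    using frechet_derivative_at assms(2) by fastforce
qed

section \<open>Uniqueness of solutions\<close>

text \<open>Gronwall argument: both curves stay in a ball on which \<open>V\<close> is Lipschitz,
  and the suitably damped squared distance between them cannot grow from its initial value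
  0.\<close>

lemma autonomous_ode_unique:
  fixes V :: "'a::euclidean_space \<Rightarrow> 'a"
  assumes V: "C_class 1 V"
    and f: "\<And>t. t \<in> {0..s} \<Longrightarrow> (f has_vector_derivative V (f t)) (at t)"
    and g: "\<And>t. t \<in> {0..s} \<Longrightarrow> (g has_vector_derivative V (g t)) (at t)"
    and eq: "f 0 = g 0" and "0 \<le> s"
  shows "f s = g s"
proof -
  have "continuous_on {0..s} f" "continuous_on {0..s} g"
    using f g by (meson continuous_at_imp_continuous_on has_vector_derivative_continuous)+
  then have "compact (f ` {0..s} \<union> g ` {0..s})"
    by (intro compact_Un compact_continuous_image) auto
  from compact_imp_bounded[OF this] obtain R where "f ` {0..s} \<union> g ` {0..s} \<subseteq> cball 0 R"
    by (auto simp: bounded_iff subset_iff)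
  moreover obtain L where
    "\<And>x y. x \<in> cball 0 R \<Longrightarrow> y \<in> cball 0 R \<Longrightarrow> norm (V x - V y) \<le> L * norm (x - y)"
    using C_class_1_lipschitz_on_compact[OF V compact_cball convex_cball] by metis
  ultimately have L: "norm (V (f t) - V (g t)) \<le> L * norm (f t - g t)" if "t \<in> {0..s}" for t
    using that by blast
  \<comment> \<open>The squared distance has derivative at most \<open>2 * L\<close> times itself,
    by Cauchy-Schwarz; the exponential weight absorbs exactly this rate.\<close>
  let ?d = "\<lambda>t. exp (- 2 * L * t) * ((f t - g t) \<bullet> (f t - g t))"
  have "?d s \<le> ?d 0"
  proof (rule DERIV_nonpos_imp_nonincreasing[OF \<open>0 \<le> s\<close>])
    fix t assume "0 \<le> t" "t \<le> s"
    then have t: "t \<in> {0..s}" by simp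
    define y where "y = exp (- 2 * L * t) *
      (2 * ((f t - g t) \<bullet> (V (f t) - V (g t))) - 2 * L * ((f t - g t) \<bullet> (f t - g t)))"
    have "((\<lambda>t. f t - g t) has_derivative (\<lambda>h. h *\<^sub>R (V (f t) - V (g t)))) (at t)"
      using has_vector_derivative_diff[OF f[OF t] g[OF t]] by (simp add: has_vector_derivative_def)
    note has_derivative_inner[OF this this]
    then have d: "((\<lambda>t. (f t - g t) \<bullet> (f t - g t)) has_real_derivative
        2 * ((f t - g t) \<bullet> (V (f t) - V (g t)))) (at t)"
      unfolding has_field_derivative_def
      by (rule has_derivative_eq_rhs) (simp add: inner_commute fun_eq_iff)
    have "((\<lambda>t. exp (- 2 * L * t)) has_real_derivative exp (- 2 * L * t) * (- 2 * L)) (at t)"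
      by (auto intro!: derivative_eq_intros)
    from DERIV_mult[OF this d] have "DERIV ?d t :> y"
      by (rule DERIV_cong) (simp add: y_def right_diff_distrib)
    moreover have "(f t - g t) \<bullet> (V (f t) - V (g t)) \<le> L * ((f t - g t) \<bullet> (f t - g t))"
    proof -
      have "(f t - g t) \<bullet> (V (f t) - V (g t)) \<le> norm (f t - g t) * (L * norm (f t - g t))"
        using norm_cauchy_schwarz mult_left_mono[OF L[OF t] norm_ge_zero] order_trans by blast
      then show ?thesis by (simp add: dot_square_norm power2_eq_square algebra_simps)
    qed
    then have "y \<le> 0"
      unfolding y_def by (intro mult_nonneg_nonpos) auto
    ultimately show "\<exists>y. DERIV ?d t :> y \<and> y \<le> 0" by blast
  qed
  then have "(f s - g s) \<bullet> (f s - g s) \<le> 0"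
    by (simp add: eq mult_le_0_iff)
  then show ?thesis by (simp add: dot_square_norm)
qed

text \<open>The maximum of \<open>u - v\<close> exists by periodicity, and the equation makes its
  value 0. Exchanging the roles of \<open>u\<close> and \<open>v\<close> later gives
  equality.\<close>

lemma classical_solution_unique_le:
  fixes u v :: "real^'n \<Rightarrow> real"
  assumes "lam > 0" and u: "classical_solution H lam u" and v: "classical_solution H lam v"
  shows "u x \<le> v x"
proof -
  have C: "C_class 1 u" "C_class 1 v"
    and P: "torus_periodic u" "torus_periodic v"
    using u v classical_solution_def by blast+
  have "torus_periodic (\<lambda>x. u x - v x)"
    using P by (simp add: torus_periodic_def)
  moreover have "continuous_on UNIV (\<lambda>x. u x - v x)"
    by (intro continuous_intros C_class_1_continuous_on C)
  ultimately obtain y where y: "\<And>x. u x - v x \<le> u y - v y"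
    using torus_periodic_attains_sup by blast
  note D = C[THEN C_class_1_has_derivative, of y]
  have "(\<lambda>h. frechet_derivative u (at y) h - frechet_derivative v (at y) h) = (\<lambda>h. 0)"
    by (rule differential_zero_maxmin[of y UNIV]) (use y has_derivative_diff[OF D] in auto)
  then have "frechet_derivative u (at y) = frechet_derivative v (at y)"
    by (simp add: fun_eq_iff)
  then have "grad u y = grad v y"
    using grad_eq_sum[OF D(1)] grad_eq_sum[OF D(2)] by simp
  moreover have "H (y, grad u y) + lam * u y = 0" "H (y, grad v y) + lam * v y = 0"
    using u v classical_solution_def by blast+
  ultimately have "lam * u y = lam * v y" by (metis add_left_cancel)
  then show ?thesis using y[of x] \<open>lam > 0\<close> by simp
qed

lemma classical_solution_unique:
  assumes "lam > 0" "classical_solution H lam u" "classical_solution H lam v"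
  shows "u = v"
  using classical_solution_unique_le[OF assms] classical_solution_unique_le[OF assms(1,3,2)]
  by (simp add: antisym ext)

section \<open>KAM tori\<close>

lemma conf_field_eq_grad:
  assumes "C_class 1 H"
  shows "conf_field H lam z = (snd (grad H z), - fst (grad H z) - lam *\<^sub>R snd z)"
proof (cases z)
  case (Pair x p)
  have "H differentiable (at (x, p))"
    using assms C_class_1_iff by blast
  from H_p_H_x_eq_grad[OF this] show ?thesis
    by (simp add: conf_field_def Pair)
qed

lemma C_class_1_conf_field:
  fixes H :: "(real^'n) \<times> (real^'n) \<Rightarrow> real"
  assumes "C_class 2 H"
  shows "C_class 1 (conf_field H lam)"
proof -
  have "C_class 1 H"
    using C_class_mono[OF assms, of 1] by simp
  \<comment> \<open>The difference is written as a sum with factor \<open>- lam\<close>, the form to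
    which the closure rules for sums and linear maps apply.\<close>
  then have eq: "conf_field H lam =
      (\<lambda>z. (snd (grad H z), - fst (grad H z) + (- lam) *\<^sub>R snd z))"
    by (intro ext) (simp only: conf_field_eq_grad, simp)
  note G = C_class_1_grad[OF assms]
  have "C_class 1 (\<lambda>z. - fst (grad H z))" "C_class 1 (\<lambda>z. snd (grad H z))"
    by (rule C_class_1_compose[OF C_class_1_bounded_linear G],
        intro bounded_linear_minus bounded_linear_fst bounded_linear_snd)+
  moreover have "C_class 1 (\<lambda>z::(real^'n) \<times> (real^'n). (- lam) *\<^sub>R snd z)"
    by (intro C_class_1_bounded_linear bounded_linear_compose[OF bounded_linear_scaleR_right]
        bounded_linear_snd)
  ultimately show ?thesis
    unfolding eq by (intro C_class_1_Pair C_class_1_add)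
qed

text \<open>\<open>conf_flow\<close> supplies a separate trajectory for each time. Uniqueness for
  the differential equation identifies them with a single one on the unit time interval, and
  differentiating that one at time 0 gives the invariance equation.\<close>

lemma conf_flow_imp_frechet_derivative:
  fixes H :: "(real^'n) \<times> (real^'n) \<Rightarrow> real"
  assumes H: "C_class 2 H" and K: "C_class 1 K"
    and flow: "\<And>t. conf_flow H lam t (K x) (K (x + t *\<^sub>R w))"
  shows "frechet_derivative K (at x) w = conf_field H lam (K x)"
proof -
  let ?V = "conf_field H lam"
  have flowE: "\<exists>\<gamma>. \<gamma> 0 = K x \<and> \<gamma> s = K (x + s *\<^sub>R w) \<and>
      (\<forall>t\<in>{0..s}. (\<gamma> has_vector_derivative ?V (\<gamma> t)) (at t))" for s
  proof -
    obtain J \<gamma> where J: "is_interval J" "0 \<in> J" "s \<in> J" and \<gamma>: "\<gamma> 0 = K x" "\<gamma> s = K (x + s *\<^sub>R w)"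
      "\<forall>t\<in>J. (\<gamma> has_vector_derivative ?V (\<gamma> t)) (at t)"
      using flow[of s] unfolding conf_flow_def by blast
    have "{0..s} \<subseteq> J"
      using mem_is_interval_1_I[OF J] by auto
    then show ?thesis using \<gamma> by blast
  qed
  obtain \<gamma> where \<gamma>: "\<gamma> 0 = K x" "\<And>t. t \<in> {0..1} \<Longrightarrow> (\<gamma> has_vector_derivative ?V (\<gamma> t)) (at t)"
    using flowE[of 1] by blast
  have \<gamma>_eq: "K (x + s *\<^sub>R w) = \<gamma> s" if "s \<in> {0..1}" for s
  proof -
    obtain \<delta> where \<delta>: "\<delta> 0 = K x" "\<delta> s = K (x + s *\<^sub>R w)"
      "\<And>t. t \<in> {0..s} \<Longrightarrow> (\<delta> has_vector_derivative ?V (\<delta> t)) (at t)"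
      using flowE[of s] by blast
    have "\<delta> s = \<gamma> s"
      by (rule autonomous_ode_unique[OF C_class_1_conf_field[OF H] \<delta>(3)])
        (use \<gamma> \<delta> that in auto)
    then show ?thesis using \<delta> by simp
  qed
  \<comment> \<open>A one-sided derivative at 0 suffices, since derivatives within a nondegenerate
    closed interval are unique.\<close>
  have "((\<lambda>s. K (x + s *\<^sub>R w)) has_vector_derivative ?V (K x)) (at 0 within {0..1})"
    by (rule has_vector_derivative_transform[of _ _ _ \<gamma>])
      (use \<gamma>(1) \<gamma>(2)[of 0] \<gamma>_eq in \<open>auto intro: has_vector_derivative_at_within\<close>)
  moreover have "((\<lambda>s. K (x + s *\<^sub>R w)) has_vector_derivative frechet_derivative K (at (x + 0 *\<^sub>R w)) w)
      (at 0 within {0..1})"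
    by (rule has_vector_derivative_along_line[OF C_class_1_has_derivative[OF K]])
  ultimately show ?thesis
    using vector_derivative_unique_within_closed_interval[of 0 1 0] by fastforce
qed

text \<open>\<open>exp (lam * t) * a t\<close> is constant, while a bounded \<open>a\<close> makes
  it tend to 0 as t tends to minus infinity.\<close>

lemma bounded_solution_of_decay_eq_0:
  fixes a :: "real \<Rightarrow> real"
  assumes "lam > 0" and a: "\<And>t. (a has_real_derivative - lam * a t) (at t)"
    and B: "\<And>t. \<bar>a t\<bar> \<le> B"
  shows "a 0 = 0"
proof -
  have const: "exp (lam * t) * a t = a 0" for t
  proof -
    have "DERIV (\<lambda>t. exp (lam * t) * a t) t :> 0" for t
      using a[of t] by (auto intro!: derivative_eq_intros)
    then show ?thesis using DERIV_isconst_all[of "\<lambda>t. exp (lam * t) * a t" t 0] by simp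
  qed
  have "0 \<le> B" using B[of 0] by linarith
  have bound: "\<bar>a 0\<bar> \<le> exp (lam * t) * B" for t
    using B[of t] by (simp add: abs_mult flip: const[of t])
  show ?thesis
  proof (rule ccontr)
    assume "a 0 \<noteq> 0"
    \<comment> \<open>At this time the exponential equals \<open>\<bar>a 0\<bar> / (B + 1)\<close>,
      and the factor \<open>B / (B + 1)\<close> is below 1.\<close>
    with bound[of "ln (\<bar>a 0\<bar> / (B + 1)) / lam"] \<open>lam > 0\<close> \<open>0 \<le> B\<close>
    have "\<bar>a 0\<bar> \<le> \<bar>a 0\<bar> / (B + 1) * B" by (simp add: exp_ln)
    with \<open>0 \<le> B\<close> \<open>a 0 \<noteq> 0\<close> show False
      by (simp add: field_simps)
  qed
qed

text \<open>The pull-back of the canonical one-form p dx to the invariant torus is exact, with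
  primitive - H / \<lambda>. The defect between the two one-forms satisfies a linear decay equation
  along the rotation and is bounded, so it vanishes.\<close>

lemma invariant_torus_exact:
  fixes H :: "(real^'n) \<times> (real^'n) \<Rightarrow> real" and \<zeta> \<eta> :: "real^'n \<Rightarrow> real^'n"
  assumes lam: "lam > 0" and H: "C_class 2 H"
    and per: "\<And>p. torus_periodic (\<lambda>x. H (x, p))"
    and \<zeta>: "C_class 1 \<zeta>" "\<And>x m. m \<in> int_lattice \<Longrightarrow> \<zeta> (x + m) = \<zeta> x + m"
    and \<eta>: "C_class 1 \<eta>" "torus_periodic \<eta>"
    and inv: "\<And>x. frechet_derivative (\<lambda>x. (\<zeta> x, \<eta> x)) (at x) \<omega> = conf_field H lam (\<zeta> x, \<eta> x)"
  shows "frechet_derivative (\<lambda>x. - H (\<zeta> x, \<eta> x) / lam) (at x) v =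
    \<eta> x \<bullet> frechet_derivative \<zeta> (at x) v"
proof -
  have H1: "C_class 1 H"
    using C_class_mono[OF H, of 1] by simp
  define U where "U x = - H (\<zeta> x, \<eta> x) / lam" for x
  define q where "q x = snd (grad H (\<zeta> x, \<eta> x))" for x
  define r where "r x = fst (grad H (\<zeta> x, \<eta> x))" for x
  let ?Z = "\<lambda>x. frechet_derivative \<zeta> (at x)" and ?E = "\<lambda>x. frechet_derivative \<eta> (at x)"
    and ?U = "\<lambda>x. frechet_derivative U (at x)" and ?Q = "\<lambda>x. frechet_derivative q (at x)"
  note K = C_class_1_Pair[OF \<zeta>(1) \<eta>(1)]
  note D\<zeta> = C_class_1_has_derivative[OF \<zeta>(1)]
  note D\<eta> = C_class_1_has_derivative[OF \<eta>(1)]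
  have q: "C_class 1 q"
    unfolding q_def
    by (intro C_class_1_compose[OF C_class_1_bounded_linear[OF bounded_linear_snd]]
        C_class_1_compose[OF C_class_1_grad[OF H] K])
  have U_eq: "U = (\<lambda>x. (- 1 / lam) *\<^sub>R H (\<zeta> x, \<eta> x))"
    by (simp add: U_def fun_eq_iff)
  have U: "C_class 1 U"
    unfolding U_eq
    by (intro C_class_1_compose[OF C_class_1_bounded_linear[OF bounded_linear_scaleR_right]]
        C_class_1_compose[OF H1 K])
  have "((\<lambda>x. H (\<zeta> x, \<eta> x)) has_derivative
      (\<lambda>v. frechet_derivative H (at (\<zeta> x, \<eta> x)) (?Z x v, ?E x v))) (at x)" for x
    by (rule has_derivative_compose[OF has_derivative_Pair[OF D\<zeta> D\<eta>] C_class_1_has_derivative[OF H1]])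
  then have "(U has_derivative (\<lambda>v. (- 1 / lam) *\<^sub>R
      frechet_derivative H (at (\<zeta> x, \<eta> x)) (?Z x v, ?E x v))) (at x)" for x
    unfolding U_eq by (intro has_derivative_scaleR_right)
  from fun_cong[OF frechet_derivative_at[OF this], symmetric]
  have DU: "?U x v = - (r x \<bullet> ?Z x v + q x \<bullet> ?E x v) / lam" for x v
    by (simp add: inner_grad[OF C_class_1_has_derivative[OF H1]] inner_prod_def q_def r_def
        add_divide_distrib diff_divide_distrib)
  have "frechet_derivative (\<lambda>x. (\<zeta> x, \<eta> x)) (at x) = (\<lambda>v. (?Z x v, ?E x v))" for x
    using frechet_derivative_at[OF has_derivative_Pair[OF D\<zeta> D\<eta>]] by simp
  then have Z\<omega>: "?Z x \<omega> = q x" and E\<omega>: "?E x \<omega> = - r x - lam *\<^sub>R \<eta> x" for x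
    using inv[of x] by (auto simp: conf_field_eq_grad[OF H1] q_def r_def)
  \<comment> \<open>The terms with \<open>r x \<bullet> q x\<close> cancel, as in conservation of
    energy; only the friction term survives, and its factor \<open>lam\<close> cancels the
    denominator.\<close>
  have U\<omega>: "?U x \<omega> = \<eta> x \<bullet> q x" for x
    using lam by (simp add: DU Z\<omega> E\<omega> inner_diff_right inner_commute)
  \<comment> \<open>The defect: the differential of \<open>U\<close> minus the pull-back of p dx,
    evaluated at \<open>v\<close>.\<close>
  define a where "a x v = ?U x v - \<eta> x \<bullet> ?Z x v" for x v
  have "((\<lambda>t. a (x + t *\<^sub>R \<omega>) v) has_real_derivative - lam * a (x + t *\<^sub>R \<omega>) v) (at t)" for t
  proof -
    let ?x = "x + t *\<^sub>R \<omega>"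
    \<comment> \<open>\<open>U\<close> is only known to be C^1, but its derivative along \<omega> is
      again C^1, which is what the interchange of derivatives requires. The same holds for \<zeta>
      in \<open>dZ\<close>.\<close>
    have dU: "((\<lambda>t. ?U (x + t *\<^sub>R \<omega>) v) has_vector_derivative
        \<eta> ?x \<bullet> ?Q ?x v + ?E ?x v \<bullet> q ?x) (at t)"
      using frechet_derivative_along_line[OF U C_class_1_inner[OF \<eta>(1) q] U\<omega>, of x v t]
      by (simp flip: frechet_derivative_at[OF has_derivative_inner[OF D\<eta> C_class_1_has_derivative[OF q]]])
    have dZ: "((\<lambda>t. ?Z (x + t *\<^sub>R \<omega>) v) has_vector_derivative ?Q ?x v) (at t)"
      by (rule frechet_derivative_along_line[OF \<zeta>(1) q Z\<omega>])
    have dE: "((\<lambda>t. \<eta> (x + t *\<^sub>R \<omega>)) has_vector_derivative - r ?x - lam *\<^sub>R \<eta> ?x) (at t)"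
      using has_vector_derivative_along_line[OF D\<eta>, of x \<omega> t] E\<omega> by simp
    have "((\<lambda>t. a (x + t *\<^sub>R \<omega>) v) has_vector_derivative
        (\<eta> ?x \<bullet> ?Q ?x v + ?E ?x v \<bullet> q ?x) -
        (\<eta> ?x \<bullet> ?Q ?x v + (- r ?x - lam *\<^sub>R \<eta> ?x) \<bullet> ?Z ?x v)) (at t)"
      unfolding a_def
      by (intro has_vector_derivative_diff dU
          bounded_bilinear.has_vector_derivative[OF bounded_bilinear_inner dE dZ])
    \<comment> \<open>The terms with the derivative of \<open>q\<close> cancel, and
      \<open>DU\<close> turns the terms with \<open>r\<close> and \<open>q\<close> into
      \<open>- lam\<close> times the derivative of \<open>U\<close>.\<close>
    moreover have "(\<eta> ?x \<bullet> ?Q ?x v + ?E ?x v \<bullet> q ?x) -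
        (\<eta> ?x \<bullet> ?Q ?x v + (- r ?x - lam *\<^sub>R \<eta> ?x) \<bullet> ?Z ?x v) = - lam * a ?x v"
      using lam by (simp add: a_def DU algebra_simps inner_commute add_divide_distrib)
    ultimately show ?thesis
      by (simp add: has_real_derivative_iff_has_vector_derivative)
  qed
  \<comment> \<open>Periodicity bounds the defect uniformly along the whole orbit, including all
    negative times.\<close>
  moreover have "torus_periodic (\<lambda>x. a x v)"
    unfolding torus_periodic_def
  proof (intro allI ballI)
    fix x m :: "real^'n" assume m: "m \<in> int_lattice"
    have "\<eta> (x + m) = \<eta> x" "U (x + m) = U x + 0" for x
      using \<eta>(2) \<zeta>(2)[OF m] per m by (auto simp: U_def torus_periodic_def)
    then show "a (x + m) v = a x v"
      using frechet_derivative_translate[of U m 0] frechet_derivative_translate[of \<zeta> m m] \<zeta> U m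
      unfolding a_def C_class_1_iff by simp
  qed
  moreover have "continuous_on UNIV (\<lambda>x. a x v)"
    unfolding a_def
    by (intro continuous_intros continuous_on_frechet_derivative U \<zeta> C_class_1_continuous_on \<eta>)
  then obtain B where "\<And>x. \<bar>a x v\<bar> \<le> B"
    using torus_periodic_bounded[OF calculation(2)] by metis
  ultimately have "a (x + 0 *\<^sub>R \<omega>) v = 0"
    using bounded_solution_of_decay_eq_0[OF lam, of "\<lambda>t. a (x + t *\<^sub>R \<omega>) v"] by blast
  then show ?thesis by (simp add: a_def U_def[abs_def])
qed

text \<open>With \<open>u\<close> defined from the equation itself, only the identity du = P
  remains. It is known after pull-back by \<zeta>, and it descends to the base because the
  derivative of \<zeta> is onto.\<close>

lemma KAM_torus_eq_graph_d:
  fixes H :: "(real^'n) \<times> (real^'n) \<Rightarrow> real"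
  assumes lam: "lam > 0" and H: "C_class 2 H"
    and per: "\<And>p. torus_periodic (\<lambda>x. H (x, p))"
    and T: "KAM_torus H lam \<omega> T"
  obtains u where "classical_solution H lam u" "T = graph_d u"
proof -
  obtain \<zeta> \<eta> where emb: "torus_embedding \<zeta> \<eta>"
    and flow: "\<And>x t. conf_flow H lam t (\<zeta> x, \<eta> x) (\<zeta> (x + t *\<^sub>R \<omega>), \<eta> (x + t *\<^sub>R \<omega>))"
    and bij: "bij \<zeta>" and P: "C_class 1 (\<lambda>x. \<eta> (inv \<zeta> x))"
    and T_eq: "T = range (\<lambda>x. (x, \<eta> (inv \<zeta> x)))"
    using T unfolding KAM_torus_def by blast
  have K: "C_class 1 (\<lambda>x. (\<zeta> x, \<eta> x))" and \<eta>: "torus_periodic \<eta>"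
    and trans: "\<And>x m. m \<in> int_lattice \<Longrightarrow> \<zeta> (x + m) = \<zeta> x + m"
    and immersion: "\<And>x. inj (frechet_derivative (\<lambda>y. (\<zeta> y, \<eta> y)) (at x))"
    using emb unfolding torus_embedding_def by blast+
  have \<zeta>1: "C_class 1 \<zeta>" and \<eta>1: "C_class 1 \<eta>"
    using C_class_1_compose[OF C_class_1_bounded_linear[OF bounded_linear_fst] K]
      C_class_1_compose[OF C_class_1_bounded_linear[OF bounded_linear_snd] K] by simp_all
  note D\<zeta> = C_class_1_has_derivative[OF \<zeta>1] and D\<eta> = C_class_1_has_derivative[OF \<eta>1]
    and DP = C_class_1_has_derivative[OF P]
  have H1: "C_class 1 H"
    using C_class_mono[OF H, of 1] by simp
  define P where "P x = \<eta> (inv \<zeta> x)" for x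
  define u where "u x = - H (x, P x) / lam" for x
  have inv_\<zeta>: "inv \<zeta> (\<zeta> x) = x" "\<zeta> (inv \<zeta> x) = x" for x
    using bij by (auto simp: bij_is_inj bij_is_surj surj_f_inv_f)
  have P\<zeta>: "P (\<zeta> x) = \<eta> x" for x
    by (simp add: P_def inv_\<zeta>)
  have "C_class 1 (\<lambda>x. (- 1 / lam) *\<^sub>R H (x, P x))"
    unfolding P_def
    by (intro C_class_1_compose[OF C_class_1_bounded_linear[OF bounded_linear_scaleR_right]]
        C_class_1_compose[OF H1] C_class_1_Pair C_class_1_bounded_linear bounded_linear_ident
        P)
  then have u1: "C_class 1 u"
    unfolding u_def by simp
  note Du = C_class_1_has_derivative[OF u1]
  \<comment> \<open>As \<eta> is \<open>P\<close> composed with \<zeta>, the derivative of the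
    embedding factors through that of \<zeta>. Immersivity therefore makes the latter injective,
    hence surjective by equality of dimensions.\<close>
  have surj: "surj (frechet_derivative \<zeta> (at x))" for x
  proof -
    have "(\<eta> has_derivative (\<lambda>v. frechet_derivative P (at (\<zeta> x)) (frechet_derivative \<zeta> (at x) v))) (at x)"
      using has_derivative_compose[OF D\<zeta> DP, of x] by (simp add: inv_\<zeta> P_def[abs_def])
    from frechet_derivative_at[OF has_derivative_Pair[OF D\<zeta> this]]
    have eq: "frechet_derivative (\<lambda>y. (\<zeta> y, \<eta> y)) (at x) =
      (\<lambda>v. (frechet_derivative \<zeta> (at x) v, frechet_derivative P (at (\<zeta> x)) (frechet_derivative \<zeta> (at x) v)))"
      by (rule sym)
    have "inj (frechet_derivative \<zeta> (at x))"
      by (intro injI injD[OF immersion[of x]]) (simp only: eq)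
    then show ?thesis
      using linear_injective_imp_surjective linear_frechet_derivative_C_class_1[OF \<zeta>1] by blast
  qed
  have grad_u: "grad u y = P y" for y
  proof (rule gderiv_eq_grad)
    define x where "x = inv \<zeta> y"
    have y: "\<zeta> x = y"
      by (simp add: x_def inv_\<zeta>)
    have "u (\<zeta> x) = - H (\<zeta> x, \<eta> x) / lam" for x
      by (simp add: u_def P\<zeta>)
    then have "((\<lambda>x. - H (\<zeta> x, \<eta> x) / lam) has_derivative
        (\<lambda>v. frechet_derivative u (at (\<zeta> x)) (frechet_derivative \<zeta> (at x) v))) (at x)"
      using has_derivative_compose[OF D\<zeta> Du, of x] by simp
    from fun_cong[OF frechet_derivative_at[OF this]]
    have "frechet_derivative u (at y) (frechet_derivative \<zeta> (at x) v) =
        P y \<bullet> frechet_derivative \<zeta> (at x) v" for v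
      using invariant_torus_exact[OF lam H per \<zeta>1 trans \<eta>1 \<eta>
          conf_flow_imp_frechet_derivative[OF H K flow], of x v] P\<zeta>[of x]
      by (simp add: y)
    \<comment> \<open>Every direction \<open>h\<close> at \<open>y\<close> is the image of some
      \<open>v\<close> under the derivative of \<zeta>.\<close>
    then have "frechet_derivative u (at y) h = h \<bullet> P y" for h
      using surj[of x] by (metis surjD inner_commute)
    then show "GDERIV u y :> P y"
      unfolding gderiv_def by (intro has_derivative_eq_rhs[OF Du] ext)
  qed
  have "inv \<zeta> (x + m) = inv \<zeta> x + m" if "m \<in> int_lattice" for x m
    using trans[OF that] inv_\<zeta> by metis
  then have "P (x + m) = P x" if "m \<in> int_lattice" for x m
    using that \<eta> by (simp add: P_def torus_periodic_def)
  then have "torus_periodic u"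
    using per by (simp add: u_def torus_periodic_def)
  then have "classical_solution H lam u"
    using lam u1 by (simp add: classical_solution_def grad_u del: One_nat_def) (simp add: u_def)
  moreover have "T = graph_d u"
    by (simp add: T_eq graph_d_def grad_u P_def)
  ultimately show thesis by (rule that)
qed

theorem theorem3:
  fixes H :: "(real^'n) \<times> (real^'n) \<Rightarrow> real" and lam :: real and r :: nat
  assumes "lam > 0"
    and "r \<ge> 2"
    and "C_class r H"
    and "\<And>p. torus_periodic (\<lambda>x. H (x, p))"
    and "tonelli H"
  shows "(\<forall>\<omega> T. KAM_torus H lam \<omega> T \<longrightarrow>
            (\<exists>u. classical_solution H lam u \<and>
                 (\<forall>v. classical_solution H lam v \<longrightarrow> v = u) \<and>
                 T = graph_d u)) \<and>
         (\<forall>\<omega>1 \<omega>2 T1 T2. KAM_torus H lam \<omega>1 T1 \<longrightarrow> KAM_torus H lam \<omega>2 T2 \<longrightarrow> T1 = T2)"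
proof -
  have H: "C_class 2 H"
    using C_class_mono assms(2,3) by blast
  note graph = KAM_torus_eq_graph_d[OF assms(1) H assms(4)]
  \<comment> \<open>Any two KAM tori, whatever their frequencies, are graphs of the differential of
    the same solution and hence coincide.\<close>
  show ?thesis
    using graph classical_solution_unique[OF assms(1), of H] by metis
qed

end
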